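(* Let $\widetilde F:\mathbb R^m\to\mathbb R$ be continuously differentiable with $L$-Lipschitz gradient, $L>0$: $\|\nabla\widetilde F(x)-\nabla\widetilde F(y)\|_2\le L\|x-y\|_2$ for all $x,y\in\mathbb R^m$. Let $(z_k)_{k\in\mathbb N_0}$ be defined by $z_{k+1}=z_k+t_ks_k$, with $z_0\in\mathbb R^m$, and for each $k$ let $g_k=\overline\nabla\widetilde F(z_k)\in\mathbb R^m$ be the inexact gradient at $z_k$. Suppose that: (i) there is $\widetilde F_{\inf}\in\mathbb R$ with $\widetilde F(z_k)\ge\widetilde F_{\inf}$ for all $k\in\mathbb N_0$; (ii) there are $c_1',c_2'>0$ with $c_1'/c_2'\le1$ such that $c_1'\|g_k\|_2^2\le-g_k^{\mathsf T}s_k$ and $\|s_k\|_2\le c_2'\|g_k\|_2$ for all $k\in\mathbb N_0$; (iii) for some $\zeta\in[0,c_1'/c_2')$, $\|g_k-\nabla\widetilde F(z_k)\|_2\le\zeta\|g_k\|_2$ for all $k\in\mathbb N_0$. Let $c_1=\frac{c_1'-\zeta c_2'}{(1+\zeta)^2}$, $c_2=\frac{c_2'}{1-\zeta}$, $C=c_1/c_2^2$, and let $t^0>0$, $\theta\in(0,1)$, $\sigma\in(0,C)$. Suppose that for each $k\in\mathbb N_0$ the step size is defined by backtracking: $$t_k=\max\left\{t\in\{t^0\theta^i: i\in\mathbb N_0\}\;:\;\widetilde F(z_k+ts_k)\le\widetilde F(z_k)-t\sigma\|s_k\|_2^2\right\}.$$ Then $$\lim_{k\to\infty}\nabla\widetilde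 F(z_k)=0,\qquad\lim_{k\to\infty}\overline\nabla\widetilde F(z_k)=0.$$ Moreover, every limit point of $(z_k)_{k\in\mathbb N_0}$ is stationary for $\widetilde F$.
   Context: $\|\cdot\|_2$ is the Euclidean norm and $\mathbb N_0=\{0,1,2,\dots\}$. The inexact gradient $\overline\nabla\widetilde F(z_k)$ is an arbitrary vector in $\mathbb R^m$ approximating $\nabla\widetilde F(z_k)$, subject only to the stated hypotheses. A limit point of a sequence is the limit of some subsequence; a stationary point is a point where $\nabla\widetilde F$ vanishes. *)

theory Defs
  imports "HOL-Analysis.Analysis"
begin

text \<open>The candidate set can be infinite (for instance
  if \<open>s = 0\<close>), so \<open>Max\<close> does not apply; its maximum is taken with \<open>Greatest\<close>, which is
  meaningful only when a greatest element exists.\<close>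

definition backtracking_candidates ::
    "('a::real_normed_vector \<Rightarrow> real) \<Rightarrow> real \<Rightarrow> real \<Rightarrow> real \<Rightarrow> 'a \<Rightarrow> 'a \<Rightarrow> real set" where
  "backtracking_candidates F \<sigma> t0 \<theta> z s =
     {t \<in> {t0 * \<theta> ^ i | i :: nat. True}. F (z + t *\<^sub>R s) \<le> F z - t * \<sigma> * (norm s)\<^sup>2}"

definition backtracking_step ::
    "('a::real_normed_vector \<Rightarrow> real) \<Rightarrow> real \<Rightarrow> real \<Rightarrow> real \<Rightarrow> 'a \<Rightarrow> 'a \<Rightarrow> real" where
  "backtracking_step F \<sigma> t0 \<theta> z s =
     (GREATEST t. t \<in> backtracking_candidates F \<sigma> t0 \<theta> z s)"

end

theory Submission
  imports Defs
begin

text \<open>The hypotheses on the inexact gradient give a true descent condition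
  \<open>C * \<parallel>s\<^sub>k\<parallel>\<^sup>2 \<le> - (\<nabla>F (z\<^sub>k) \<bullet> s\<^sub>k)\<close>. With the Lipschitz gradient, every step of length at most
  \<open>(C - \<sigma>) / L\<close> passes the backtracking test, so the accepted steps are bounded below by
  \<open>\<tau> = min t0 (\<theta> * (C - \<sigma>) / L) > 0\<close>. Hence \<open>F (z\<^sub>k)\<close> drops by at least \<open>\<tau> * \<sigma> * \<parallel>s\<^sub>k\<parallel>\<^sup>2\<close> in
  each iteration, and boundedness from below forces \<open>s\<^sub>k \<longlonglongrightarrow> 0\<close>. Finally \<open>c1' * \<parallel>g\<^sub>k\<parallel> \<le> \<parallel>s\<^sub>k\<parallel>\<close>
  by Cauchy-Schwarz, so \<open>g\<^sub>k\<close>, and with it \<open>\<nabla>F (z\<^sub>k)\<close>, tends to \<open>0\<close>.\<close>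

text \<open>Along the segment the mean value theorem gives a slope at an intermediate point, which
  the Lipschitz bound compares with the slope at \<open>z\<close>. Integrating the gradient would
  give \<open>L / 2\<close> instead of \<open>L\<close>; the cruder constant only shrinks the range
  of steps known to be accepted.\<close>

lemma lipschitz_gradient_upper_bound:
  fixes F :: "'a::real_inner \<Rightarrow> real"
  assumes grad: "\<And>x. GDERIV F x :> gradF x"
    and lipschitz: "\<And>x y. norm (gradF x - gradF y) \<le> L * norm (x - y)"
    and "u \<ge> 0"
  shows "F (z + u *\<^sub>R s) \<le> F z + u * (gradF z \<bullet> s) + L * u\<^sup>2 * (norm s)\<^sup>2"
proof (cases "u = 0")
  case False
  with \<open>u \<ge> 0\<close> have "u > 0" by simp
  have deriv: "((\<lambda>v. F (z + v *\<^sub>R s)) has_real_derivative gradF (z + v *\<^sub>R s) \<bullet> s) (at v)" for v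
  proof -
    have "((\<lambda>v. z + v *\<^sub>R s) has_derivative (\<lambda>h. h *\<^sub>R s)) (at v)"
      by (auto intro!: derivative_eq_intros)
    moreover have "(F has_derivative (\<lambda>h. h \<bullet> gradF (z + v *\<^sub>R s))) (at (z + v *\<^sub>R s))"
      using grad unfolding gderiv_def .
    ultimately have "((\<lambda>v. F (z + v *\<^sub>R s)) has_derivative
        (\<lambda>h. (h *\<^sub>R s) \<bullet> gradF (z + v *\<^sub>R s))) (at v)"
      by (rule has_derivative_compose)
    then show ?thesis
      by (simp add: has_field_derivative_def inner_commute mult_commute_abs)
  qed
  obtain v where v: "0 < v" "v < u"
    and mvt: "F (z + u *\<^sub>R s) - F (z + 0 *\<^sub>R s) = (u - 0) * (gradF (z + v *\<^sub>R s) \<bullet> s)"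
    using MVT2[OF \<open>u > 0\<close> deriv] by metis
  \<comment> \<open>The sign of \<open>L\<close> is obtained from the Lipschitz bound itself,
    applied to \<open>s\<close> and \<open>0\<close>, in the form needed below to replace
    \<open>v\<close> by the larger \<open>u\<close>.\<close>
  have "0 \<le> L * norm s"
    using order_trans[OF norm_ge_zero lipschitz[of s 0]] by simp
  have "(gradF (z + v *\<^sub>R s) - gradF z) \<bullet> s \<le> norm (gradF (z + v *\<^sub>R s) - gradF z) * norm s"
    by (rule norm_cauchy_schwarz)
  also have "\<dots> \<le> (L * norm (v *\<^sub>R s)) * norm s"
    using lipschitz[of "z + v *\<^sub>R s" z] by (intro mult_right_mono) auto
  also have "\<dots> = v * ((L * norm s) * norm s)"
    using v by simp
  also have "\<dots> \<le> u * ((L * norm s) * norm s)"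
    using v \<open>0 \<le> L * norm s\<close> by (intro mult_right_mono) auto
  finally have "gradF (z + v *\<^sub>R s) \<bullet> s \<le> gradF z \<bullet> s + u * ((L * norm s) * norm s)"
    by (simp add: inner_diff_left)
  then have "u * (gradF (z + v *\<^sub>R s) \<bullet> s) \<le> u * (gradF z \<bullet> s + u * ((L * norm s) * norm s))"
    using \<open>u > 0\<close> by (intro mult_left_mono) auto
  then show ?thesis
    using mvt by (simp add: algebra_simps power2_eq_square)
qed simp

text \<open>Since \<open>t0 * \<theta> ^ i\<close> tends to 0, some trial step lies below
  \<open>\<delta>\<close> and is accepted, so the candidate set is nonempty. Trial steps decrease in
  \<open>i\<close>, so the least accepted exponent gives a greatest candidate and
  \<open>GREATEST\<close> is meaningful.\<close>

lemma backtracking_step_sufficient: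
  assumes t0: "t0 > 0" and theta: "0 < \<theta>" "\<theta> < 1" and "0 < \<delta>"
    and accept: "\<And>u. \<lbrakk>0 < u; u \<le> \<delta>\<rbrakk> \<Longrightarrow> F (z + u *\<^sub>R s) \<le> F z - u * \<sigma> * (norm s)\<^sup>2"
  shows "backtracking_step F \<sigma> t0 \<theta> z s \<in> backtracking_candidates F \<sigma> t0 \<theta> z s"
    and "min t0 (\<theta> * \<delta>) \<le> backtracking_step F \<sigma> t0 \<theta> z s"
proof -
  define A where "A = backtracking_candidates F \<sigma> t0 \<theta> z s"
  have A_iff: "t0 * \<theta> ^ i \<in> A \<longleftrightarrow>
      F (z + (t0 * \<theta> ^ i) *\<^sub>R s) \<le> F z - (t0 * \<theta> ^ i) * \<sigma> * (norm s)\<^sup>2" for i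
    by (auto simp: A_def backtracking_candidates_def)
  have small: "t0 * \<theta> ^ i \<in> A" if "t0 * \<theta> ^ i \<le> \<delta>" for i
    using accept[OF _ that] t0 theta by (simp add: A_iff)
  obtain n where "\<theta> ^ n < \<delta> / t0"
    using real_arch_pow_inv[of "\<delta> / t0" \<theta>] \<open>0 < \<delta>\<close> t0 theta by auto
  then have "t0 * \<theta> ^ n \<in> A"
    using t0 by (intro small) (simp add: field_simps)
  define i where "i = (LEAST i. t0 * \<theta> ^ i \<in> A)"
  have iA: "t0 * \<theta> ^ i \<in> A"
    unfolding i_def using \<open>t0 * \<theta> ^ n \<in> A\<close> by (rule LeastI)
  have max: "t \<le> t0 * \<theta> ^ i" if tA: "t \<in> A" for t
  proof -
    obtain j where j: "t = t0 * \<theta> ^ j"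
      using tA by (auto simp: A_def backtracking_candidates_def)
    then have "i \<le> j"
      using tA unfolding i_def by (auto intro: Least_le)
    then show ?thesis
      using t0 theta by (auto simp: j intro: power_decreasing)
  qed
  have step: "backtracking_step F \<sigma> t0 \<theta> z s = t0 * \<theta> ^ i"
    unfolding backtracking_step_def A_def[symmetric]
    using iA max by (rule Greatest_equality)
  show "backtracking_step F \<sigma> t0 \<theta> z s \<in> backtracking_candidates F \<sigma> t0 \<theta> z s"
    using iA step by (simp add: A_def)
  show "min t0 (\<theta> * \<delta>) \<le> backtracking_step F \<sigma> t0 \<theta> z s"
  proof (cases i)
    case (Suc j)
    \<comment> \<open>The trial just before the accepted one was rejected, so it exceeds
      \<open>\<delta>\<close>; one further factor \<open>\<theta>\<close> leaves at least
      \<open>\<theta> * \<delta>\<close>.\<close>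
    then have "t0 * \<theta> ^ j \<notin> A"
      unfolding i_def by (intro not_less_Least) simp
    then have "\<delta> \<le> t0 * \<theta> ^ j"
      using small by force
    then have "\<theta> * \<delta> \<le> t0 * \<theta> ^ i"
      using theta by (simp add: Suc mult.left_commute)
    then show ?thesis
      by (simp add: step)
  qed (simp add: step)
qed

text \<open>A decreasing sequence bounded below converges, so its consecutive drops tend to 0, and
  they dominate \<open>c * (norm (s k))\<^sup>2\<close>.\<close>

lemma sufficient_decrease_imp_tendsto_0:
  fixes f :: "nat \<Rightarrow> real" and s :: "nat \<Rightarrow> 'a::real_normed_vector"
  assumes bounded: "\<And>k. B \<le> f k" and "0 < c"
    and decrease: "\<And>k. f (Suc k) \<le> f k - c * (norm (s k))\<^sup>2"
  shows "s \<longlonglongrightarrow> 0"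
proof -
  have "f (Suc k) \<le> f k" for k
    using decrease[of k] \<open>0 < c\<close> by (smt (verit) mult_nonneg_nonneg zero_le_power2)
  then have "decseq f"
    by (simp add: decseq_Suc_iff)
  then obtain l where "f \<longlonglongrightarrow> l"
    using decseq_convergent bounded by blast
  then have "(\<lambda>k. (f k - f (Suc k)) / c) \<longlonglongrightarrow> (l - l) / c"
    using \<open>0 < c\<close> by (intro tendsto_intros LIMSEQ_Suc) auto
  then have drop: "(\<lambda>k. (f k - f (Suc k)) / c) \<longlonglongrightarrow> 0"
    by simp
  have "(\<lambda>k. (norm (s k))\<^sup>2) \<longlonglongrightarrow> 0"
  proof (rule tendsto_sandwich[OF _ _ tendsto_const drop])
    show "\<forall>\<^sub>F k in sequentially. (norm (s k))\<^sup>2 \<le> (f k - f (Suc k)) / c"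
      using decrease \<open>0 < c\<close> by (intro always_eventually allI) (simp add: field_simps)
  qed simp
  then have "(\<lambda>k. sqrt ((norm (s k))\<^sup>2)) \<longlonglongrightarrow> sqrt 0"
    by (rule tendsto_real_sqrt)
  then show ?thesis
    by (simp add: tendsto_norm_zero_iff)
qed

text \<open>Replacing \<open>g\<close> by \<open>d\<close> changes the inner product with
  \<open>s\<close> by at most \<open>\<zeta> * c2' * (norm g)\<^sup>2\<close>, so descent survives
  with constant \<open>c1' - \<zeta> * c2' > 0\<close>; the bound on \<open>norm s\<close> then
  trades \<open>norm g\<close> for \<open>norm s\<close>.\<close>

lemma inexact_descent_direction:
  fixes d g s :: "'a::real_inner"
  assumes "0 < c1'" "0 < c2'" "c1' / c2' \<le> 1" "0 \<le> \<zeta>" "\<zeta> < c1' / c2'"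
    and descent: "c1' * (norm g)\<^sup>2 \<le> - (g \<bullet> s)"
    and bound: "norm s \<le> c2' * norm g"
    and inexact: "norm (g - d) \<le> \<zeta> * norm g"
  shows "(c1' - \<zeta> * c2') / (1 + \<zeta>)\<^sup>2 / (c2' / (1 - \<zeta>))\<^sup>2 * (norm s)\<^sup>2 \<le> - (d \<bullet> s)"
proof -
  define D where "D = c1' - \<zeta> * c2'"
  have "D > 0"
    using assms(2,5) by (simp add: D_def field_simps)
  have "\<zeta> < 1"
    using assms(3,5) by simp
  have "(d - g) \<bullet> s \<le> norm (g - d) * norm s"
    using norm_cauchy_schwarz[of "d - g" s] by (simp add: norm_minus_commute)
  also have "\<dots> \<le> (\<zeta> * norm g) * (c2' * norm g)"
    using bound inexact assms(4) by (intro mult_mono) auto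
  finally have *: "D * (norm g)\<^sup>2 \<le> - (d \<bullet> s)"
    using descent by (simp add: D_def inner_diff_left power2_eq_square algebra_simps)
  have "(norm s)\<^sup>2 \<le> (c2' * norm g)\<^sup>2"
    using bound by (intro power_mono) auto
  then have "D / c2'\<^sup>2 * (norm s)\<^sup>2 \<le> D / c2'\<^sup>2 * (c2' * norm g)\<^sup>2"
    using \<open>D > 0\<close> by (intro mult_left_mono) auto
  also have "\<dots> = D * (norm g)\<^sup>2"
    using assms(2) by (simp add: power_mult_distrib)
  finally have "D / c2'\<^sup>2 * (norm s)\<^sup>2 \<le> - (d \<bullet> s)"
    using * by linarith
  \<comment> \<open>The stated constant is what a detour through \<open>norm d\<close> would give.
    Working with \<open>norm g\<close> yields the larger \<open>D / c2'\<^sup>2\<close>, and the two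
    differ by a factor at most 1.\<close>
  moreover have "D / (1 + \<zeta>)\<^sup>2 / (c2' / (1 - \<zeta>))\<^sup>2 = ((1 - \<zeta>) / (1 + \<zeta>))\<^sup>2 * (D / c2'\<^sup>2)"
    by (simp add: power_divide)
  moreover have "((1 - \<zeta>) / (1 + \<zeta>))\<^sup>2 \<le> 1"
    using assms(4) \<open>\<zeta> < 1\<close> by (intro power_le_one) auto
  then have "((1 - \<zeta>) / (1 + \<zeta>))\<^sup>2 * (D / c2'\<^sup>2) * (norm s)\<^sup>2 \<le> D / c2'\<^sup>2 * (norm s)\<^sup>2"
    using \<open>D > 0\<close> by (intro mult_right_mono mult_left_le_one_le) auto
  ultimately show ?thesis
    unfolding D_def[symmetric] by simp
qed

theorem theorem5p12:
  fixes F :: "real ^ 'm \<Rightarrow> real" and gradF :: "real ^ 'm \<Rightarrow> real ^ 'm"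
    and z s g :: "nat \<Rightarrow> real ^ 'm" and t :: "nat \<Rightarrow> real"
    and L F_inf c1' c2' \<zeta> c1 c2 C t0 \<theta> \<sigma> :: real
  assumes grad: "\<And>x. GDERIV F x :> gradF x"
    and grad_cont: "continuous_on UNIV gradF"
    and L_pos: "L > 0"
    and grad_lipschitz: "\<And>x y. norm (gradF x - gradF y) \<le> L * norm (x - y)"
    and iteration: "\<And>k. z (Suc k) = z k + t k *\<^sub>R s k"
    and bounded_below: "\<And>k. F (z k) \<ge> F_inf"
    and c_pos: "c1' > 0" "c2' > 0"
    and c_ratio: "c1' / c2' \<le> 1"
    and descent: "\<And>k. c1' * (norm (g k))\<^sup>2 \<le> - (g k \<bullet> s k)"
    and direction_bound: "\<And>k. norm (s k) \<le> c2' * norm (g k)"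
    and zeta: "\<zeta> \<in> {0..<c1' / c2'}"
    and inexact: "\<And>k. norm (g k - gradF (z k)) \<le> \<zeta> * norm (g k)"
    and c1: "c1 = (c1' - \<zeta> * c2') / (1 + \<zeta>)\<^sup>2"
    and c2: "c2 = c2' / (1 - \<zeta>)"
    and C: "C = c1 / c2\<^sup>2"
    and t0: "t0 > 0"
    and theta: "\<theta> \<in> {0<..<1}"
    and sigma: "\<sigma> \<in> {0<..<C}"
    and step: "\<And>k. t k = backtracking_step F \<sigma> t0 \<theta> (z k) (s k)"
  shows "(\<lambda>k. gradF (z k)) \<longlonglongrightarrow> 0 \<and> g \<longlonglongrightarrow> 0 \<and>
    (\<forall>x r. strict_mono r \<and> (z \<circ> r) \<longlonglongrightarrow> x \<longrightarrow> gradF x = 0)"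
proof -
  \<comment> \<open>For \<open>u \<le> \<delta>\<close> the quadratic error
    \<open>L * u\<^sup>2\<close> is at most \<open>u * (C - \<sigma>)\<close>, the surplus of the
    true descent over the required decrease.\<close>
  define \<delta> where "\<delta> = (C - \<sigma>) / L"
  define \<tau> where "\<tau> = min t0 (\<theta> * \<delta>)"
  have "\<delta> > 0" "\<tau> > 0"
    using sigma L_pos theta t0 by (auto simp: \<delta>_def \<tau>_def)
  have true_descent: "C * (norm (s k))\<^sup>2 \<le> - (gradF (z k) \<bullet> s k)" for k
    unfolding C c1 c2
    using c_pos c_ratio zeta descent[of k] direction_bound[of k] inexact[of k]
    by (intro inexact_descent_direction[of _ _ _ "g k"]) auto
  have accept: "F (z k + u *\<^sub>R s k) \<le> F (z k) - u * \<sigma> * (norm (s k))\<^sup>2"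
    if "0 < u" "u \<le> \<delta>" for k u
  proof -
    have "F (z k + u *\<^sub>R s k) \<le> F (z k) + u * (gradF (z k) \<bullet> s k) + L * u\<^sup>2 * (norm (s k))\<^sup>2"
      using grad grad_lipschitz that by (intro lipschitz_gradient_upper_bound) auto
    also have "u * (gradF (z k) \<bullet> s k) \<le> u * - (C * (norm (s k))\<^sup>2)"
      using true_descent[of k] that by (intro mult_left_mono) auto
    also have "L * u\<^sup>2 * (norm (s k))\<^sup>2 \<le> u * (C - \<sigma>) * (norm (s k))\<^sup>2"
    proof (rule mult_right_mono)
      have "L * u \<le> C - \<sigma>"
        using that L_pos by (simp add: \<delta>_def field_simps)
      then have "u * (L * u) \<le> u * (C - \<sigma>)"
        using that by (intro mult_left_mono) auto
      then show "L * u\<^sup>2 \<le> u * (C - \<sigma>)"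
        by (simp add: power2_eq_square mult_ac)
    qed simp
    finally show ?thesis
      by (simp add: algebra_simps)
  qed
  have "0 < \<theta>" "\<theta> < 1"
    using theta by auto
  \<comment> \<open>Membership is not automatic for \<open>GREATEST\<close>; it follows because all
    small steps are accepted.\<close>
  have candidate: "t k \<in> backtracking_candidates F \<sigma> t0 \<theta> (z k) (s k)" for k
    unfolding step
    by (rule backtracking_step_sufficient(1)[OF t0 \<open>0 < \<theta>\<close> \<open>\<theta> < 1\<close> \<open>\<delta> > 0\<close>]) (rule accept)
  have "\<tau> \<le> t k" for k
    unfolding step \<tau>_def
    by (rule backtracking_step_sufficient(2)[OF t0 \<open>0 < \<theta>\<close> \<open>\<theta> < 1\<close> \<open>\<delta> > 0\<close>]) (rule accept)
  have "F (z (Suc k)) \<le> F (z k) - (\<tau> * \<sigma>) * (norm (s k))\<^sup>2" for k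
  proof -
    have "F (z (Suc k)) \<le> F (z k) - t k * \<sigma> * (norm (s k))\<^sup>2"
      using candidate[of k] by (simp add: iteration backtracking_candidates_def)
    moreover have "\<tau> * \<sigma> * (norm (s k))\<^sup>2 \<le> t k * \<sigma> * (norm (s k))\<^sup>2"
      using \<open>\<tau> \<le> t k\<close> sigma by (intro mult_right_mono) auto
    ultimately show ?thesis
      by linarith
  qed
  then have "s \<longlonglongrightarrow> 0"
    using bounded_below \<open>\<tau> > 0\<close> sigma
    by (intro sufficient_decrease_imp_tendsto_0[of F_inf "\<lambda>k. F (z k)" "\<tau> * \<sigma>"]) auto
  have "norm (g k) \<le> norm (s k) * (1 / c1')" for k
  proof (cases "g k = 0")
    case True
    then show ?thesis
      using c_pos by simp
  next
    case False
    have "c1' * (norm (g k))\<^sup>2 \<le> norm (g k) * norm (s k)"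
      using descent[of k] norm_cauchy_schwarz[of "- g k" "s k"] by simp
    then have "norm (g k) * (c1' * norm (g k)) \<le> norm (g k) * norm (s k)"
      by (simp add: power2_eq_square mult_ac)
    then have "c1' * norm (g k) \<le> norm (s k)"
      using False by simp
    then show ?thesis
      using c_pos by (simp add: field_simps)
  qed
  then have g_lim: "g \<longlonglongrightarrow> 0"
    by (intro tendsto_0_le[OF \<open>s \<longlonglongrightarrow> 0\<close>] always_eventually allI)
  have "norm (gradF (z k)) \<le> norm (g k) * (1 + \<zeta>)" for k
    using inexact[of k] norm_triangle_sub[of "gradF (z k)" "g k"]
    by (simp add: norm_minus_commute algebra_simps)
  then have grad_lim: "(\<lambda>k. gradF (z k)) \<longlonglongrightarrow> 0"
    by (intro tendsto_0_le[OF g_lim] always_eventually allI)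
  \<comment> \<open>Along the subsequence the gradients tend to \<open>gradF x\<close> by continuity
    and to 0 by \<open>grad_lim\<close>, so the limits agree.\<close>
  have "gradF x = 0" if "strict_mono r" "(z \<circ> r) \<longlonglongrightarrow> x" for x r
  proof (rule LIMSEQ_unique)
    have "isCont gradF x"
      using grad_cont by (simp add: continuous_on_eq_continuous_at)
    then show "(\<lambda>k. gradF ((z \<circ> r) k)) \<longlonglongrightarrow> gradF x"
      using that(2) by (rule isCont_tendsto_compose)
    show "(\<lambda>k. gradF ((z \<circ> r) k)) \<longlonglongrightarrow> 0"
      using LIMSEQ_subseq_LIMSEQ[OF grad_lim that(1)] by (simp add: o_def)
  qed
  then show ?thesis
    using g_lim grad_lim by blast
qed

end
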